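(* Let $p\geq4$, $K=\mathrm S(\mathrm{GL}(p)\times\mathrm{GL}(2))$, let $Ke\subset\mathfrak p$ be the spherical nilpotent $K$-orbit with signed partition $(+3^2,+1^{p-4})$, and let $X$ be the wonderful compactification of $K/\mathrm N_K(K_e)$, with set of spherical roots $\Sigma$ and colors $\Delta=\{D_1,D_2,D_3,D_4,D_5\}$. The semigroup $$\Gamma_{\Delta_{\mathfrak p}(e)}=\{(n_1,n_2,E)\in\mathbb N^2\times\mathbb N\Delta : E\leq_\Sigma n_1D_{\mathfrak p_1}+n_2D_{\mathfrak p_2}\}$$ is generated by $$(1,0,D_1),\ (0,1,D_2),\ (1,1,D_3),\ (2,0,D_4),\ (0,2,D_5).$$
   Context: Everything is over $\mathbb C$; $\mathbb N$ contains $0$. Let $G=\mathrm{SL}(p+2)\supset K$. Let $e_1,\dots,e_p$ be a basis of $\mathbb C^p$ with dual basis $\varphi_1,\dots,\varphi_p$, and $e'_1,e'_2$ a basis of $\mathbb C^2$ with dual basis $\varphi'_1,\varphi'_2$. The isotropy representation is $\mathfrak p=\mathfrak p_1\oplus\mathfrak p_2$, $\mathfrak p_1=\mathbb C^p\otimes(\mathbb C^2)^*$, $\mathfrak p_2=(\mathbb C^p)^*\otimes\mathbb C^2$. A representative of the orbit is $$e=e_1\otimes\varphi'_1+e_2\otimes\varphi'_2+\varphi_{p-1}\otimes e'_1+\varphi_p\otimes e'_2 .$$ Let $B\subset K$ be the standard Borel subgroup; the simple roots of $\mathrm{GL}(p)$ are $\alpha_1,\dots,\alpha_{p-1}$ and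 the one of $\mathrm{GL}(2)$ is $\alpha'$. A wonderful $K$-variety is a smooth projective $K$-variety with an open $K$-orbit whose complement is a union of smooth prime divisors with normal crossings and non-empty total intersection, such that two points are in the same orbit if and only if they lie in the same boundary divisors. The homogeneous space $K/\mathrm N_K(K_e)$ is the open orbit of a unique wonderful $K$-variety $X$. Its set of colors $\Delta$ is the set of $B$-stable, non-$K$-stable prime divisors; $\mathrm{Pic}(X)=\mathbb Z\Delta$, writing $\mathcal L_D$ for the line bundle of $D$, and $\mathbb N\Delta$ corresponds to the globally generated line bundles. The set of spherical roots $\Sigma$ is the set of $T$-weights on $\mathrm T_{y_0}X/\mathrm T_{y_0}Y$, with $T\subset B$ the maximal torus, $Y$ the closed orbit and $y_0\in Y$ the point fixed by the opposite Borel subgroup; spherical roots correspond bijectively to $K$-stable prime divisors, so that $\mathbb Z\Sigma\subset\mathrm{Pic}(X)=\mathbb Z\Delta$. For $D,E\in\mathbb N\Delta$, $D\leq_\Sigma E$ means $E-D\in\mathbb N\Sigma$. A simple root $\alpha$ moves a color $D$ if $P_\alpha D\neq D$, where $P_\alpha\supset B$ is the minimal parabolic subgroup of $\alpha$. Here $\Sigma=\{\sigma_1,\sigma_2,\sigma_3\}$ with $\sigma_1=\alpha'$, $\sigma_2=\alpha_1$, $\sigma_3=\alpha_{p-1}$, and the colors are: $D_1=D_{\alpha'}^+$ (moved by $\alpha'$ and $\alpha_{p-1}$), $D_2=D_{\alpha'}^-$ (moved by $\alpha'$ and $\alpha_1$), $D_3=D_{\alpha_1}^+$ (moved by $\alpha_1$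 and $\alpha_{p-1}$), $D_4=D_{\alpha_{p-2}}$ (moved by $\alpha_{p-2}$), $D_5=D_{\alpha_2}$ (moved by $\alpha_2$); if $p=4$ then $D_4=D_5$. In $\mathbb Z\Delta$: $\sigma_1=D_1+D_2-D_3$, $\sigma_1+\sigma_3=2D_1-D_4$, $\sigma_1+\sigma_2=2D_2-D_5$. For $i=1,2$, $D_{\mathfrak p_i}\in\mathbb N\Delta$ is the element such that $\mathcal L_{D_{\mathfrak p_i}}$ is the pullback of $\mathcal O(1)$ along the equivariant morphism $X\to\mathbb P(\mathfrak p_i)$ extending the map induced by the projection $Ke\to\mathfrak p_i$; here $D_{\mathfrak p_1}=D_1$ and $D_{\mathfrak p_2}=D_2$. $\Delta_{\mathfrak p}(e)=\{D_{\mathfrak p_1},D_{\mathfrak p_2}\}$. *)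

theory Defs
  imports
    "HOL-Analysis.Analysis"
    "HOL-Library.Poly_Mapping"
    "HOL-Library.Product_Plus"
    "HOL-Algebra.Group_Action"
    "Jordan_Normal_Form.Determinant"
begin

hide_const (open) Determinants.det Matrix.vec Matrix.row Matrix.col
no_notation vec_index (infixl \<open>$\<close> 100)

section \<open>Projective varieties over the complex numbers\<close>

text \<open>A subset of the projective space of \<open>V = complex ^ 'n\<close> is encoded by the set of all nonzero
  vectors spanning one of its points. Thus unions, intersections, complements and the empty set have
  their literal meaning, and a point is a nonzero vector up to nonzero scalars. Polynomials are
  encoded as polynomial functions, which is faithful as the field is infinite.\<close>

inductive_set algebra_gen :: "('a \<Rightarrow> complex) set \<Rightarrow> ('a \<Rightarrow> complex) set"
  for C :: "('a \<Rightarrow> complex) set" where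
  const: "(\<lambda>_. a) \<in> algebra_gen C"
| coord: "f \<in> C \<Longrightarrow> f \<in> algebra_gen C"
| add: "f \<in> algebra_gen C \<Longrightarrow> g \<in> algebra_gen C \<Longrightarrow> (\<lambda>x. f x + g x) \<in> algebra_gen C"
| mult: "f \<in> algebra_gen C \<Longrightarrow> g \<in> algebra_gen C \<Longrightarrow> (\<lambda>x. f x * g x) \<in> algebra_gen C"

definition poly_fun :: "(complex ^ 'n \<Rightarrow> complex) set" where
  "poly_fun = algebra_gen (range (\<lambda>i v. v $ i))"

definition mat_poly_fun :: "nat \<Rightarrow> (complex mat \<Rightarrow> complex) set" where
  "mat_poly_fun m = algebra_gen {\<lambda>g. g $$ (i, j) | i j. i < m \<and> j < m}"

definition form :: "nat \<Rightarrow> (complex ^ 'n \<Rightarrow> complex) set" where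
  "form d = {f \<in> poly_fun. \<forall>c v. f (c *s v) = c ^ d * f v}"

definition proj_closed :: "(complex ^ 'n) set \<Rightarrow> bool" where
  "proj_closed Z \<longleftrightarrow> (\<exists>S \<subseteq> (\<Union>d. form d). Z = {v. v \<noteq> 0 \<and> (\<forall>f\<in>S. f v = 0)})"

definition proj_irreducible :: "(complex ^ 'n) set \<Rightarrow> bool" where
  "proj_irreducible Z \<longleftrightarrow> proj_closed Z \<and> Z \<noteq> {} \<and>
     (\<forall>A B. proj_closed A \<and> proj_closed B \<and> Z = A \<union> B \<longrightarrow> Z = A \<or> Z = B)"

definition proj_dim :: "(complex ^ 'n) set \<Rightarrow> nat" where
  "proj_dim Z = (GREATEST n. \<exists>c :: nat \<Rightarrow> (complex ^ 'n) set.
     (\<forall>i\<le>n. proj_irreducible (c i) \<and> c i \<subseteq> Z) \<and> (\<forall>i<n. c i \<subset> c (Suc i)))"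

definition vanishing :: "(complex ^ 'n) set \<Rightarrow> (complex ^ 'n \<Rightarrow> complex) set" where
  "vanishing Z = {f \<in> poly_fun. \<forall>v\<in>Z. f v = 0}"

text \<open>The Zariski tangent space at \<open>v\<close> of the affine cone over \<open>Z\<close>. The tangent space of \<open>Z\<close> at the
  point \<open>[v]\<close> is its quotient by the line of \<open>v\<close>, tensored with the dual of that line.\<close>

definition cone_tangent :: "(complex ^ 'n) set \<Rightarrow> complex ^ 'n \<Rightarrow> (complex ^ 'n) set" where
  "cone_tangent Z v = {w. \<forall>f\<in>vanishing Z. deriv (\<lambda>t. f (v + t *s w)) 0 = 0}"

definition proj_smooth :: "(complex ^ 'n) set \<Rightarrow> bool" where
  "proj_smooth Z \<longleftrightarrow> (\<forall>v\<in>Z. vec.dim (cone_tangent Z v) = proj_dim Z + 1)"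

text \<open>In an irreducible variety, codimension one means maximal among proper irreducible closed
  subsets.\<close>

definition prime_divisors :: "(complex ^ 'n) set \<Rightarrow> (complex ^ 'n) set set" where
  "prime_divisors X = {D. proj_irreducible D \<and> D \<subset> X \<and>
     (\<forall>Z. proj_irreducible Z \<and> D \<subseteq> Z \<and> Z \<subset> X \<longrightarrow> Z = D)}"

text \<open>For finitely many smooth prime divisors: at each point of \<open>X\<close> the tangent hyperplanes of the
  divisors passing through it are linearly independent.\<close>

definition normal_crossings :: "(complex ^ 'n) set \<Rightarrow> (complex ^ 'n) set set \<Rightarrow> bool" where
  "normal_crossings X \<D> \<longleftrightarrow> (\<forall>v\<in>X.
     vec.dim (cone_tangent X v \<inter> (\<Inter>D\<in>{D\<in>\<D>. v \<in> D}. cone_tangent D v)) + card {D\<in>\<D>. v \<in> D}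
       = vec.dim (cone_tangent X v))"


section \<open>Divisors and linear equivalence\<close>

primrec ideal_power :: "(complex ^ 'n \<Rightarrow> complex) set \<Rightarrow> nat \<Rightarrow> (complex ^ 'n \<Rightarrow> complex) set" where
  "ideal_power I 0 = poly_fun"
| "ideal_power I (Suc k) = {\<lambda>v. \<Sum>i<m. f i v * g i v | (m :: nat) f g.
      \<forall>i<m. f i \<in> I \<and> g i \<in> ideal_power I k}"

text \<open>The order of vanishing along \<open>D\<close> of a form \<open>F\<close> not vanishing identically on \<open>X\<close>: the largest \<open>k\<close>
  such that \<open>F\<close> lies in the \<open>k\<close>-th power of the maximal ideal of the local ring of \<open>X\<close> at the generic
  point of \<open>D\<close>, i.e. in the localization at the homogeneous prime ideal of \<open>D\<close>.\<close>

definition vanishing_order ::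
    "(complex ^ 'n) set \<Rightarrow> (complex ^ 'n) set \<Rightarrow> (complex ^ 'n \<Rightarrow> complex) \<Rightarrow> nat" where
  "vanishing_order X D F = (GREATEST k. \<exists>H \<in> poly_fun - vanishing D.
     \<exists>a \<in> ideal_power (vanishing D) k. \<exists>b \<in> vanishing X. \<forall>v. H v * F v = a v + b v)"

text \<open>Divisors are finite formal integral combinations of prime divisors. Two of them are linearly
  equivalent if they differ by the divisor of a rational function \<open>F / G\<close>; on a smooth variety this
  is isomorphism of the associated line bundles.\<close>

definition lin_equiv ::
    "(complex ^ 'n) set \<Rightarrow> ((complex ^ 'n) set \<Rightarrow>\<^sub>0 int) \<Rightarrow> ((complex ^ 'n) set \<Rightarrow>\<^sub>0 int) \<Rightarrow> bool" where
  "lin_equiv X A B \<longleftrightarrow>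
     Poly_Mapping.keys A \<subseteq> prime_divisors X \<and> Poly_Mapping.keys B \<subseteq> prime_divisors X \<and>
     (\<exists>d. \<exists>F \<in> form d - vanishing X. \<exists>G \<in> form d - vanishing X. \<forall>D\<in>prime_divisors X.
        Poly_Mapping.lookup A D - Poly_Mapping.lookup B D
          = int (vanishing_order X D F) - int (vanishing_order X D G))"


section \<open>Morphisms to the projective space of a space of matrices\<close>

text \<open>A map from \<open>X\<close> to the projective space of a space \<open>W\<close> of \<open>m \<times> m\<close> matrices is given by a choice
  \<open>\<phi> v\<close> of a nonzero matrix spanning the image of \<open>[v]\<close>. It is a morphism if it is locally given by
  tuples of forms of the same degree.\<close>

definition local_rep :: "nat \<Rightarrow> (complex ^ 'n) set \<Rightarrow> (complex ^ 'n \<Rightarrow> complex mat)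
    \<Rightarrow> (complex ^ 'n \<Rightarrow> complex mat) \<Rightarrow> bool" where
  "local_rep m X \<phi> F \<longleftrightarrow> (\<forall>v. F v \<in> carrier_mat m m) \<and>
     (\<exists>d. \<forall>i<m. \<forall>j<m. (\<lambda>v. F v $$ (i, j)) \<in> form d) \<and>
     (\<forall>v\<in>X. F v \<noteq> 0\<^sub>m m m \<longrightarrow> (\<exists>c. c \<noteq> 0 \<and> F v = c \<cdot>\<^sub>m \<phi> v))"

definition proj_morphism :: "nat \<Rightarrow> (complex ^ 'n) set \<Rightarrow> complex mat set
    \<Rightarrow> (complex ^ 'n \<Rightarrow> complex mat) \<Rightarrow> bool" where
  "proj_morphism m X W \<phi> \<longleftrightarrow> (\<forall>v\<in>X. \<phi> v \<in> W \<and> \<phi> v \<noteq> 0\<^sub>m m m \<and>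
     (\<exists>F. local_rep m X \<phi> F \<and> F v \<noteq> 0\<^sub>m m m))"

definition linear_form :: "nat \<Rightarrow> complex mat \<Rightarrow> complex mat \<Rightarrow> complex" where
  "linear_form m L M = (\<Sum>i<m. \<Sum>j<m. L $$ (i, j) * M $$ (i, j))"

text \<open>\<open>A\<close> is the pullback along \<open>\<phi>\<close> of the hyperplane defined by some linear form not vanishing
  identically on the image; its line bundle is the pullback of \<open>\<O>(1)\<close>. The multiplicity along \<open>D\<close> is
  computed with a local expression of \<open>\<phi>\<close> at the generic point of \<open>D\<close>.\<close>

definition hyperplane_pullback :: "nat \<Rightarrow> (complex ^ 'n) set \<Rightarrow> (complex ^ 'n \<Rightarrow> complex mat)
    \<Rightarrow> ((complex ^ 'n) set \<Rightarrow>\<^sub>0 int) \<Rightarrow> bool" where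
  "hyperplane_pullback m X \<phi> A \<longleftrightarrow> Poly_Mapping.keys A \<subseteq> prime_divisors X \<and>
     (\<exists>L. (\<exists>v\<in>X. linear_form m L (\<phi> v) \<noteq> 0) \<and>
       (\<forall>D\<in>prime_divisors X. \<exists>F. local_rep m X \<phi> F \<and> (\<exists>v\<in>D. F v \<noteq> 0\<^sub>m m m) \<and>
          Poly_Mapping.lookup A D = int (vanishing_order X D (\<lambda>v. linear_form m L (F v)))))"


section \<open>The group and the isotropy representation\<close>

text \<open>Elements of \<open>K = S(GL(p) \<times> GL(2))\<close> are the block diagonal matrices in \<open>SL(p+2)\<close>, and the
  isotropy representation consists of the block antidiagonal matrices, \<open>K\<close> acting by conjugation.
  Indices start from zero.\<close>

definition K :: "nat \<Rightarrow> complex mat set" where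
  "K p = {g \<in> carrier_mat (p + 2) (p + 2). Determinant.det g = 1 \<and>
     (\<forall>i<p+2. \<forall>j<p+2. (i < p) \<noteq> (j < p) \<longrightarrow> g $$ (i, j) = 0)}"

definition K_group :: "nat \<Rightarrow> complex mat monoid" where
  "K_group p = \<lparr>carrier = K p, monoid.mult = (*), one = 1\<^sub>m (p + 2)\<rparr>"

definition borel_K :: "nat \<Rightarrow> complex mat set" where
  "borel_K p = {g \<in> K p. \<forall>i<p+2. \<forall>j<i. g $$ (i, j) = 0}"

definition opposite_borel_K :: "nat \<Rightarrow> complex mat set" where
  "opposite_borel_K p = {g \<in> K p. \<forall>j<p+2. \<forall>i<j. g $$ (i, j) = 0}"

definition torus_K :: "nat \<Rightarrow> complex mat set" where
  "torus_K p = {g \<in> K p. diagonal_mat g}"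

text \<open>The simple roots are indexed by \<open>{1..p-1} \<union> {p+1}\<close>: the index \<open>i < p\<close> stands for the simple root
  \<open>\<alpha>\<^sub>i\<close> of \<open>GL(p)\<close>, and the index \<open>p + 1\<close> for the simple root \<open>\<alpha>'\<close> of \<open>GL(2)\<close>.\<close>

definition simple_root_indices :: "nat \<Rightarrow> nat set" where
  "simple_root_indices p = {1..<p} \<union> {p + 1}"

definition simple_root :: "nat \<Rightarrow> nat \<Rightarrow> complex mat \<Rightarrow> complex" where
  "simple_root p i = restrict (\<lambda>t. t $$ (i - 1, i - 1) / t $$ (i, i)) (torus_K p)"

definition minimal_parabolic :: "nat \<Rightarrow> nat \<Rightarrow> complex mat set" where
  "minimal_parabolic p i = {g \<in> K p. \<forall>r<p+2. \<forall>s<r. (r, s) \<noteq> (i, i - 1) \<longrightarrow> g $$ (r, s) = 0}"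

definition adjoint_action :: "nat \<Rightarrow> complex mat \<Rightarrow> complex mat \<Rightarrow> complex mat" where
  "adjoint_action p g M = g * M * inv\<^bsub>K_group p\<^esub> g"

definition block :: "nat \<Rightarrow> nat \<Rightarrow> (nat \<times> nat) set" where
  "block p i = (if i = 1 then {0..<p} \<times> {p..<p+2} else {p..<p+2} \<times> {0..<p})"

text \<open>The summands \<open>\<pp>\<^sub>1 = Hom(\<complex>\<^sup>2, \<complex>\<^sup>p)\<close> and \<open>\<pp>\<^sub>2 = Hom(\<complex>\<^sup>p, \<complex>\<^sup>2)\<close>.\<close>

definition isotropy :: "nat \<Rightarrow> nat \<Rightarrow> complex mat set" where
  "isotropy p i = {M \<in> carrier_mat (p + 2) (p + 2).
     \<forall>r<p+2. \<forall>s<p+2. (r, s) \<notin> block p i \<longrightarrow> M $$ (r, s) = 0}"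

definition isotropy_proj :: "nat \<Rightarrow> nat \<Rightarrow> complex mat \<Rightarrow> complex mat" where
  "isotropy_proj p i M = mat (p + 2) (p + 2) (\<lambda>rs. if rs \<in> block p i then M $$ rs else 0)"

text \<open>\<open>e = e\<^sub>1 \<otimes> \<phi>'\<^sub>1 + e\<^sub>2 \<otimes> \<phi>'\<^sub>2 + \<phi>\<^sub>p\<^sub>-\<^sub>1 \<otimes> e'\<^sub>1 + \<phi>\<^sub>p \<otimes> e'\<^sub>2\<close>, a representative of the orbit of signed
  partition \<open>(+3\<^sup>2, +1\<^sup>p\<^sup>-\<^sup>4)\<close>: its Jordan strings \<open>e\<^sub>p\<^sub>-\<^sub>1 \<mapsto> e'\<^sub>1 \<mapsto> e\<^sub>1\<close> and \<open>e\<^sub>p \<mapsto> e'\<^sub>2 \<mapsto> e\<^sub>2\<close> have length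
  three, the remaining ones are the \<open>e\<^sub>i\<close> for \<open>2 < i < p - 1\<close>.\<close>

definition nilp :: "nat \<Rightarrow> complex mat" where
  "nilp p = mat (p + 2) (p + 2)
     (\<lambda>rs. if rs \<in> {(0, p), (1, p + 1), (p, p - 2), (p + 1, p - 1)} then 1 else 0)"

definition K_stabilizer :: "nat \<Rightarrow> complex mat set" where
  "K_stabilizer p = stabilizer (K_group p) (adjoint_action p) (nilp p)"


section \<open>Wonderful varieties\<close>

text \<open>A projective \<open>K\<close>-variety is a closed \<open>K\<close>-stable subvariety of the projectivization of a rational
  \<open>K\<close>-module, given by \<open>\<rho>\<close>. For smooth varieties this is no restriction: \<open>K\<close> is connected, so a power
  of any ample line bundle is \<open>K\<close>-linearizable. Note that \<open>K\<close> is closed in the space of matrices, so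
  its regular functions are the restrictions of polynomials.\<close>

definition rational_rep :: "nat \<Rightarrow> (complex mat \<Rightarrow> complex ^ 'n ^ 'n) \<Rightarrow> bool" where
  "rational_rep p \<rho> \<longleftrightarrow> \<rho> (1\<^sub>m (p + 2)) = Finite_Cartesian_Product.mat 1 \<and>
     (\<forall>g\<in>K p. \<forall>h\<in>K p. \<rho> (g * h) = \<rho> g ** \<rho> h) \<and>
     (\<forall>i j. \<exists>f \<in> mat_poly_fun (p + 2). \<forall>g\<in>K p. \<rho> g $ i $ j = f g)"

definition translate ::
    "(complex mat \<Rightarrow> complex ^ 'n ^ 'n) \<Rightarrow> complex mat \<Rightarrow> (complex ^ 'n) set \<Rightarrow> (complex ^ 'n) set" where
  "translate \<rho> g Z = (\<lambda>v. \<rho> g *v v) ` Z"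

definition stable ::
    "complex mat set \<Rightarrow> (complex mat \<Rightarrow> complex ^ 'n ^ 'n) \<Rightarrow> (complex ^ 'n) set \<Rightarrow> bool" where
  "stable H \<rho> Z \<longleftrightarrow> (\<forall>h\<in>H. translate \<rho> h Z = Z)"

definition proj_orbit ::
    "nat \<Rightarrow> (complex mat \<Rightarrow> complex ^ 'n ^ 'n) \<Rightarrow> complex ^ 'n \<Rightarrow> (complex ^ 'n) set" where
  "proj_orbit p \<rho> v = {c *s (\<rho> g *v v) | c g. c \<noteq> 0 \<and> g \<in> K p}"

definition projective_K_variety ::
    "nat \<Rightarrow> (complex mat \<Rightarrow> complex ^ 'n ^ 'n) \<Rightarrow> (complex ^ 'n) set \<Rightarrow> bool" where
  "projective_K_variety p \<rho> X \<longleftrightarrow> rational_rep p \<rho> \<and> proj_irreducible X \<and> stable (K p) \<rho> X"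

definition wonderful ::
    "nat \<Rightarrow> (complex mat \<Rightarrow> complex ^ 'n ^ 'n) \<Rightarrow> (complex ^ 'n) set \<Rightarrow> bool" where
  "wonderful p \<rho> X \<longleftrightarrow> projective_K_variety p \<rho> X \<and> proj_smooth X \<and>
     (\<exists>x\<in>X. \<exists>\<D>. finite \<D> \<and> \<D> \<subseteq> prime_divisors X \<and>
        proj_closed (X - proj_orbit p \<rho> x) \<and> X - proj_orbit p \<rho> x = \<Union>\<D> \<and>
        (\<forall>D\<in>\<D>. proj_smooth D) \<and> normal_crossings X \<D> \<and> X \<inter> \<Inter>\<D> \<noteq> {} \<and>
        (\<forall>v\<in>X. \<forall>w\<in>X. proj_orbit p \<rho> v = proj_orbit p \<rho> w \<longleftrightarrow> (\<forall>D\<in>\<D>. v \<in> D \<longleftrightarrow> w \<in> D)))"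

text \<open>\<open>[x]\<close> lies in the open orbit and its stabilizer is the normalizer of \<open>K\<^sub>e\<close>; in characteristic
  zero the open orbit is then isomorphic to \<open>K / N\<^sub>K(K\<^sub>e)\<close>, with \<open>[x]\<close> corresponding to the trivial
  coset.\<close>

definition base_point ::
    "nat \<Rightarrow> (complex mat \<Rightarrow> complex ^ 'n ^ 'n) \<Rightarrow> (complex ^ 'n) set \<Rightarrow> complex ^ 'n \<Rightarrow> bool" where
  "base_point p \<rho> X x \<longleftrightarrow> x \<in> X \<and> proj_closed (X - proj_orbit p \<rho> x) \<and>
     {g \<in> K p. \<exists>c. \<rho> g *v x = c *s x} = normalizer (K_group p) (K_stabilizer p)"

definition wonderful_compactification ::
    "nat \<Rightarrow> (complex mat \<Rightarrow> complex ^ 'n ^ 'n) \<Rightarrow> (complex ^ 'n) set \<Rightarrow> bool" where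
  "wonderful_compactification p \<rho> X \<longleftrightarrow> wonderful p \<rho> X \<and> (\<exists>x. base_point p \<rho> X x)"

definition boundary_divisors ::
    "nat \<Rightarrow> (complex mat \<Rightarrow> complex ^ 'n ^ 'n) \<Rightarrow> (complex ^ 'n) set \<Rightarrow> (complex ^ 'n) set set" where
  "boundary_divisors p \<rho> X = {D \<in> prime_divisors X. stable (K p) \<rho> D}"

definition colors ::
    "nat \<Rightarrow> (complex mat \<Rightarrow> complex ^ 'n ^ 'n) \<Rightarrow> (complex ^ 'n) set \<Rightarrow> (complex ^ 'n) set set" where
  "colors p \<rho> X = {D \<in> prime_divisors X. stable (borel_K p) \<rho> D \<and> \<not> stable (K p) \<rho> D}"

definition moving_roots ::
    "nat \<Rightarrow> (complex mat \<Rightarrow> complex ^ 'n ^ 'n) \<Rightarrow> (complex ^ 'n) set \<Rightarrow> nat set" where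
  "moving_roots p \<rho> D =
     {i \<in> simple_root_indices p. (\<Union>g\<in>minimal_parabolic p i. translate \<rho> g D) \<noteq> D}"

definition color_lattice :: "nat \<Rightarrow> (complex mat \<Rightarrow> complex ^ 'n ^ 'n) \<Rightarrow> (complex ^ 'n) set
    \<Rightarrow> ((complex ^ 'n) set \<Rightarrow>\<^sub>0 int) set" where
  "color_lattice p \<rho> X = {E. Poly_Mapping.keys E \<subseteq> colors p \<rho> X}"

definition color_monoid :: "nat \<Rightarrow> (complex mat \<Rightarrow> complex ^ 'n ^ 'n) \<Rightarrow> (complex ^ 'n) set
    \<Rightarrow> ((complex ^ 'n) set \<Rightarrow>\<^sub>0 int) set" where
  "color_monoid p \<rho> X = {E \<in> color_lattice p \<rho> X. \<forall>D. 0 \<le> Poly_Mapping.lookup E D}"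

text \<open>The class of a divisor under the identification of the Picard group with the lattice of
  colors.\<close>

definition pic_class :: "nat \<Rightarrow> (complex mat \<Rightarrow> complex ^ 'n ^ 'n) \<Rightarrow> (complex ^ 'n) set
    \<Rightarrow> ((complex ^ 'n) set \<Rightarrow>\<^sub>0 int) \<Rightarrow> ((complex ^ 'n) set \<Rightarrow>\<^sub>0 int)" where
  "pic_class p \<rho> X A = (THE E. E \<in> color_lattice p \<rho> X \<and> lin_equiv X A E)"


section \<open>Spherical roots\<close>

text \<open>\<open>[y]\<close> is the point of the closed orbit fixed by the opposite Borel subgroup.\<close>

definition distinguished_point ::
    "nat \<Rightarrow> (complex mat \<Rightarrow> complex ^ 'n ^ 'n) \<Rightarrow> (complex ^ 'n) set \<Rightarrow> complex ^ 'n \<Rightarrow> bool" where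
  "distinguished_point p \<rho> X y \<longleftrightarrow> y \<in> X \<and> proj_closed (proj_orbit p \<rho> y) \<and>
     (\<forall>b\<in>opposite_borel_K p. \<exists>c. \<rho> b *v y = c *s y)"

text \<open>\<open>\<sigma>\<close> is the weight of a \<open>T\<close>-eigenvector in the quotient of the tangent spaces of \<open>X\<close> and \<open>Z\<close> at the
  \<open>T\<close>-fixed point \<open>[y]\<close>. The factor \<open>c\<close>, the weight of the line of \<open>y\<close>, accounts for the twist by the
  dual of this line in the tangent space of a projective space.\<close>

definition normal_weight :: "nat \<Rightarrow> (complex mat \<Rightarrow> complex ^ 'n ^ 'n) \<Rightarrow> (complex ^ 'n) set
    \<Rightarrow> (complex ^ 'n) set \<Rightarrow> complex ^ 'n \<Rightarrow> (complex mat \<Rightarrow> complex) \<Rightarrow> bool" where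
  "normal_weight p \<rho> X Z y \<sigma> \<longleftrightarrow> (\<exists>w \<in> cone_tangent X y - cone_tangent Z y.
     \<forall>t\<in>torus_K p. \<exists>c. \<rho> t *v y = c *s y \<and> \<rho> t *v w - (c * \<sigma> t) *s w \<in> cone_tangent Z y)"

definition spherical_roots :: "nat \<Rightarrow> (complex mat \<Rightarrow> complex ^ 'n ^ 'n) \<Rightarrow> (complex ^ 'n) set
    \<Rightarrow> (complex mat \<Rightarrow> complex) set" where
  "spherical_roots p \<rho> X = {\<sigma> \<in> extensional (torus_K p).
     \<exists>y. distinguished_point p \<rho> X y \<and> normal_weight p \<rho> X (proj_orbit p \<rho> y) y \<sigma>}"

text \<open>The bijection between spherical roots and \<open>K\<close>-stable prime divisors sends \<open>\<sigma>\<close> to the divisor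
  whose normal line at the distinguished point has weight \<open>\<sigma>\<close>.\<close>

definition root_divisor :: "nat \<Rightarrow> (complex mat \<Rightarrow> complex ^ 'n ^ 'n) \<Rightarrow> (complex ^ 'n) set
    \<Rightarrow> (complex mat \<Rightarrow> complex) \<Rightarrow> (complex ^ 'n) set" where
  "root_divisor p \<rho> X \<sigma> = (THE D. D \<in> boundary_divisors p \<rho> X \<and>
     (\<exists>y. distinguished_point p \<rho> X y \<and> normal_weight p \<rho> X D y \<sigma>))"

definition root_class :: "nat \<Rightarrow> (complex mat \<Rightarrow> complex ^ 'n ^ 'n) \<Rightarrow> (complex ^ 'n) set
    \<Rightarrow> (complex mat \<Rightarrow> complex) \<Rightarrow> ((complex ^ 'n) set \<Rightarrow>\<^sub>0 int)" where
  "root_class p \<rho> X \<sigma> = pic_class p \<rho> X (frag_of (root_divisor p \<rho> X \<sigma>))"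

definition le_Sigma :: "nat \<Rightarrow> (complex mat \<Rightarrow> complex ^ 'n ^ 'n) \<Rightarrow> (complex ^ 'n) set
    \<Rightarrow> ((complex ^ 'n) set \<Rightarrow>\<^sub>0 int) \<Rightarrow> ((complex ^ 'n) set \<Rightarrow>\<^sub>0 int) \<Rightarrow> bool" where
  "le_Sigma p \<rho> X D E \<longleftrightarrow> (\<exists>c :: (complex mat \<Rightarrow> complex) \<Rightarrow> nat.
     E - D = (\<Sum>\<sigma>\<in>spherical_roots p \<rho> X. frag_cmul (int (c \<sigma>)) (root_class p \<rho> X \<sigma>)))"


section \<open>The semigroup\<close>

text \<open>\<open>\<phi>\<close> is the equivariant morphism from \<open>X\<close> to the projective space of \<open>\<pp>\<^sub>i\<close> extending the map induced
  by the projection of the nilpotent orbit \<open>Ke\<close> to \<open>\<pp>\<^sub>i\<close>.\<close>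

definition isotropy_morphism :: "nat \<Rightarrow> (complex mat \<Rightarrow> complex ^ 'n ^ 'n) \<Rightarrow> (complex ^ 'n) set
    \<Rightarrow> nat \<Rightarrow> (complex ^ 'n \<Rightarrow> complex mat) \<Rightarrow> bool" where
  "isotropy_morphism p \<rho> X i \<phi> \<longleftrightarrow> proj_morphism (p + 2) X (isotropy p i) \<phi> \<and>
     (\<exists>x. base_point p \<rho> X x \<and> (\<forall>g\<in>K p. \<exists>c. c \<noteq> 0 \<and>
        \<phi> (\<rho> g *v x) = c \<cdot>\<^sub>m isotropy_proj p i (adjoint_action p g (nilp p))))"

definition D_isotropy :: "nat \<Rightarrow> (complex mat \<Rightarrow> complex ^ 'n ^ 'n) \<Rightarrow> (complex ^ 'n) set
    \<Rightarrow> nat \<Rightarrow> ((complex ^ 'n) set \<Rightarrow>\<^sub>0 int)" where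
  "D_isotropy p \<rho> X i = (THE E. E \<in> color_monoid p \<rho> X \<and>
     (\<exists>\<phi> A. isotropy_morphism p \<rho> X i \<phi> \<and> hyperplane_pullback (p + 2) X \<phi> A \<and> lin_equiv X A E))"

definition isotropy_semigroup :: "nat \<Rightarrow> (complex mat \<Rightarrow> complex ^ 'n ^ 'n) \<Rightarrow> (complex ^ 'n) set
    \<Rightarrow> (nat \<times> nat \<times> ((complex ^ 'n) set \<Rightarrow>\<^sub>0 int)) set" where
  "isotropy_semigroup p \<rho> X = {(n1, n2, E). E \<in> color_monoid p \<rho> X \<and>
     le_Sigma p \<rho> X E (frag_cmul (int n1) (D_isotropy p \<rho> X 1) + frag_cmul (int n2) (D_isotropy p \<rho> X 2))}"

inductive_set generated_monoid :: "'a :: monoid_add set \<Rightarrow> 'a set" for S :: "'a set" where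
  zero: "0 \<in> generated_monoid S"
| add: "x \<in> S \<Longrightarrow> y \<in> generated_monoid S \<Longrightarrow> x + y \<in> generated_monoid S"

end

theory Submission
  imports Defs
begin

text \<open>Write \<open>s\<^sub>1, s\<^sub>2, s\<^sub>3\<close> for the classes of the spherical roots and let
  \<open>E = n\<^sub>1 D\<^sub>1 + n\<^sub>2 D\<^sub>2 - c\<^sub>1 s\<^sub>1 - c\<^sub>2 s\<^sub>2 - c\<^sub>3 s\<^sub>3\<close>. The relations give
  \<open>E = a\<^sub>1 D\<^sub>1 + a\<^sub>2 D\<^sub>2 + a\<^sub>3 D\<^sub>3 + c\<^sub>3 D\<^sub>4 + c\<^sub>2 D\<^sub>5\<close> with \<open>a\<^sub>3 = c\<^sub>1 - c\<^sub>2 - c\<^sub>3\<close>,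
  \<open>n\<^sub>1 = a\<^sub>1 + a\<^sub>3 + 2 c\<^sub>3\<close> and \<open>n\<^sub>2 = a\<^sub>2 + a\<^sub>3 + 2 c\<^sub>2\<close>. If \<open>E\<close> is effective then
  \<open>a\<^sub>1, a\<^sub>2, a\<^sub>3\<close> are nonnegative, even when \<open>D\<^sub>4 = D\<^sub>5\<close>, and they are with \<open>c\<^sub>3, c\<^sub>2\<close> the
  coefficients of \<open>(n\<^sub>1, n\<^sub>2, E)\<close> on the five generators.\<close>

lemma generated_monoid_incl: "x \<in> S \<Longrightarrow> x \<in> generated_monoid S"
  using generated_monoid.add[OF _ generated_monoid.zero] by fastforce

text \<open>The inductive rule only prepends one generator at a time, so closure under sums comes by
  associativity.\<close>

lemma generated_monoid_add:
  "x \<in> generated_monoid S \<Longrightarrow> y \<in> generated_monoid S \<Longrightarrow> x + y \<in> generated_monoid S"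
  by (induction rule: generated_monoid.induct) (auto simp: add.assoc intro: generated_monoid.add)

lemma generated_monoid_subset:
  assumes "S \<subseteq> M" "0 \<in> M" "\<And>x y. x \<in> M \<Longrightarrow> y \<in> M \<Longrightarrow> x + y \<in> M"
  shows "generated_monoid S \<subseteq> M"
proof
  show "x \<in> M" if "x \<in> generated_monoid S" for x
    using that by induction (use assms in auto)
qed

text \<open>A \<open>k\<close>-fold sum, with the scaling written componentwise, so that multiples
  of the five generators can be recognized.\<close>

lemma generated_monoid_cmul:
  fixes E :: "'a \<Rightarrow>\<^sub>0 int"
  assumes "(m, n, E) \<in> generated_monoid S"
  shows "(k * m, k * n, frag_cmul (int k) E) \<in> generated_monoid S"
proof (induction k)
  case 0
  then show ?case
    using generated_monoid.zero[of S] by (simp add: zero_prod_def)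
next
  case (Suc k)
  then show ?case
    using generated_monoid_add[OF assms Suc] by (simp add: frag_cmul_distrib)
qed

lemma zero_in_color_monoid: "0 \<in> color_monoid p \<rho> X"
  by (simp add: color_monoid_def color_lattice_def)

lemma add_in_color_monoid:
  "E \<in> color_monoid p \<rho> X \<Longrightarrow> F \<in> color_monoid p \<rho> X \<Longrightarrow> E + F \<in> color_monoid p \<rho> X"
  using Poly_Mapping.keys_add[of E F] by (fastforce simp: color_monoid_def color_lattice_def lookup_add)

lemma frag_of_in_color_monoid: "D \<in> colors p \<rho> X \<Longrightarrow> frag_of D \<in> color_monoid p \<rho> X"
  by (simp add: color_monoid_def color_lattice_def lookup_single when_def)

lemma le_Sigma_refl: "le_Sigma p \<rho> X E E"
  unfolding le_Sigma_def by (rule exI[of _ "\<lambda>_. 0"]) simp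

text \<open>The coefficients of the spherical roots add up.\<close>

lemma le_Sigma_add:
  assumes "le_Sigma p \<rho> X E F" "le_Sigma p \<rho> X E' F'"
  shows "le_Sigma p \<rho> X (E + E') (F + F')"
proof -
  from assms obtain c c' where
    "F - E = (\<Sum>\<sigma>\<in>spherical_roots p \<rho> X. frag_cmul (int (c \<sigma>)) (root_class p \<rho> X \<sigma>))"
    "F' - E' = (\<Sum>\<sigma>\<in>spherical_roots p \<rho> X. frag_cmul (int (c' \<sigma>)) (root_class p \<rho> X \<sigma>))"
    unfolding le_Sigma_def by blast
  then have "(F + F') - (E + E')
      = (\<Sum>\<sigma>\<in>spherical_roots p \<rho> X. frag_cmul (int (c \<sigma> + c' \<sigma>)) (root_class p \<rho> X \<sigma>))"
    by (simp add: frag_cmul_distrib sum.distrib algebra_simps)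
  then show ?thesis
    unfolding le_Sigma_def by (intro exI[of _ "\<lambda>\<sigma>. c \<sigma> + c' \<sigma>"])
qed

lemma isotropy_semigroup_zero: "0 \<in> isotropy_semigroup p \<rho> X"
  by (simp add: isotropy_semigroup_def zero_prod_def zero_in_color_monoid le_Sigma_refl)

lemma isotropy_semigroup_add:
  assumes "x \<in> isotropy_semigroup p \<rho> X" "y \<in> isotropy_semigroup p \<rho> X"
  shows "x + y \<in> isotropy_semigroup p \<rho> X"
proof -
  obtain m n E m' n' E' where xy: "x = (m, n, E)" "y = (m', n', E')"
    by (metis prod_cases3)
  have "le_Sigma p \<rho> X (E + E')
     ((frag_cmul (int m) (D_isotropy p \<rho> X 1) + frag_cmul (int n) (D_isotropy p \<rho> X 2)) +
      (frag_cmul (int m') (D_isotropy p \<rho> X 1) + frag_cmul (int n') (D_isotropy p \<rho> X 2)))"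
    using assms unfolding xy isotropy_semigroup_def by (intro le_Sigma_add) auto
  then show ?thesis
    using assms add_in_color_monoid[of E p \<rho> X E']
    by (simp add: xy isotropy_semigroup_def frag_cmul_distrib algebra_simps)
qed

theorem proposition4p6:
  fixes p :: nat
    and \<rho> :: "complex mat \<Rightarrow> complex ^ 'n ^ 'n"
    and X D1 D2 D3 D4 D5 :: "(complex ^ 'n) set"
  assumes p: "4 \<le> p"
    and X: "wonderful_compactification p \<rho> X"
    and Sigma: "spherical_roots p \<rho> X = {simple_root p (p + 1), simple_root p 1, simple_root p (p - 1)}"
    and Delta: "colors p \<rho> X = {D1, D2, D3, D4, D5}"
    and D1: "moving_roots p \<rho> D1 = {p + 1, p - 1}"
    and D2: "moving_roots p \<rho> D2 = {p + 1, 1}"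
    and D3: "moving_roots p \<rho> D3 = {1, p - 1}"
    and D4: "moving_roots p \<rho> D4 = {p - 2}"
    and D5: "moving_roots p \<rho> D5 = {2}"
    and D45: "p = 4 \<Longrightarrow> D4 = D5"
    and sigma1: "root_class p \<rho> X (simple_root p (p + 1)) = frag_of D1 + frag_of D2 - frag_of D3"
    and sigma13: "root_class p \<rho> X (simple_root p (p + 1)) + root_class p \<rho> X (simple_root p (p - 1))
                  = frag_cmul 2 (frag_of D1) - frag_of D4"
    and sigma12: "root_class p \<rho> X (simple_root p (p + 1)) + root_class p \<rho> X (simple_root p 1)
                  = frag_cmul 2 (frag_of D2) - frag_of D5"
    and Dp1: "D_isotropy p \<rho> X 1 = frag_of D1"
    and Dp2: "D_isotropy p \<rho> X 2 = frag_of D2"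
  shows "isotropy_semigroup p \<rho> X = generated_monoid
           {(1, 0, frag_of D1), (0, 1, frag_of D2), (1, 1, frag_of D3),
            (2, 0, frag_of D4), (0, 2, frag_of D5)}"
proof -
  let ?G = "{(1, 0, frag_of D1), (0, 1, frag_of D2), (1, 1, frag_of D3),
    (2, 0, frag_of D4), (0, 2, frag_of D5)} :: (nat \<times> nat \<times> ((complex ^ 'n) set \<Rightarrow>\<^sub>0 int)) set"
  define r1 r2 r3 where r: "r1 = simple_root p (p + 1)" "r2 = simple_root p 1"
    "r3 = simple_root p (p - 1)"
  define s1 s2 s3 where s: "s1 = root_class p \<rho> X r1" "s2 = root_class p \<rho> X r2"
    "s3 = root_class p \<rho> X r3"
  have s1: "s1 = frag_of D1 + frag_of D2 - frag_of D3"
    using sigma1 by (simp add: r s)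
  have s13: "s1 + s3 = frag_of D1 + frag_of D1 - frag_of D4"
    using sigma13 frag_cmul_distrib[of 1 1 "frag_of D1"] by (simp add: r s)
  have s12: "s1 + s2 = frag_of D2 + frag_of D2 - frag_of D5"
    using sigma12 frag_cmul_distrib[of 1 1 "frag_of D2"] by (simp add: r s)
  have s3: "s3 = frag_of D1 - frag_of D2 + frag_of D3 - frag_of D4"
    using s13 unfolding s1 by (simp add: algebra_simps)
  have s2: "s2 = frag_of D2 - frag_of D1 + frag_of D3 - frag_of D5"
    using s12 unfolding s1 by (simp add: algebra_simps)
  \<comment> \<open>The sets of moving roots separate these pairs as \<open>4 \<le> p\<close>. The
    pair \<open>D4\<close>, \<open>D5\<close> is left out: for \<open>p = 4\<close> the two
    coincide.\<close>
  have "D1 \<noteq> D2" "D1 \<noteq> D3" "D2 \<noteq> D3" "D1 \<noteq> D4" "D1 \<noteq> D5" "D2 \<noteq> D4" "D2 \<noteq> D5" "D3 \<noteq> D4" "D3 \<noteq> D5"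
    using p D1 D2 D3 D4 D5 by (auto simp: doubleton_eq_iff)
  note distinct = this this[symmetric]
  note lookups = lookup_add lookup_minus lookup_single when_def
  \<comment> \<open>The coefficients at \<open>D3\<close> and \<open>D1\<close> tell the three
    classes apart, whether or not \<open>D4 = D5\<close>.\<close>
  have "Poly_Mapping.lookup s1 D3 = -1" "Poly_Mapping.lookup s2 D3 = 1"
    "Poly_Mapping.lookup s3 D3 = 1" "Poly_Mapping.lookup s2 D1 = -1" "Poly_Mapping.lookup s3 D1 = 1"
    using distinct by (simp_all add: s1 s2 s3 lookups)
  then have "s1 \<noteq> s2" "s1 \<noteq> s3" "s2 \<noteq> s3"
    by auto
  \<comment> \<open>Roots with distinct classes are distinct, so no evaluation on the torus is
    needed to split the sum over the set of roots into three terms.\<close>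
  then have r_distinct: "r1 \<noteq> r2" "r1 \<noteq> r3" "r2 \<noteq> r3"
    unfolding s by auto
  have sum_roots: "(\<Sum>\<sigma>\<in>spherical_roots p \<rho> X. frag_cmul (int (c \<sigma>)) (root_class p \<rho> X \<sigma>))
      = frag_cmul (int (c r1)) s1 + frag_cmul (int (c r2)) s2 + frag_cmul (int (c r3)) s3" for c
    unfolding Sigma r(1)[symmetric] r(2)[symmetric] r(3)[symmetric] using r_distinct
    by (simp add: s add.assoc)
  have le_SigmaI: "le_Sigma p \<rho> X E F"
    if "F - E = frag_cmul (int c1) s1 + frag_cmul (int c2) s2 + frag_cmul (int c3) s3" for E F c1 c2 c3
    unfolding le_Sigma_def sum_roots
    \<comment> \<open>The last branch serves \<open>r3\<close>; values outside the three roots never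
      enter the sum.\<close>
    by (rule exI[of _ "\<lambda>\<sigma>. if \<sigma> = r1 then c1 else if \<sigma> = r2 then c2 else c3"])
      (use that r_distinct in auto)

  have "generated_monoid ?G \<subseteq> isotropy_semigroup p \<rho> X"
  proof (rule generated_monoid_subset)
    have colors: "frag_of D \<in> color_monoid p \<rho> X" if "D \<in> {D1, D2, D3, D4, D5}" for D
      using that Delta frag_of_in_color_monoid by metis
    \<comment> \<open>The last three generators differ from their bounds by \<open>s1\<close>,
      \<open>s1 + s3\<close> and \<open>s1 + s2\<close>.\<close>
    have "le_Sigma p \<rho> X (frag_of D3) (frag_of D1 + frag_of D2)"
      by (rule le_SigmaI[of _ _ 1 0 0]) (simp add: s1)
    moreover have "le_Sigma p \<rho> X (frag_of D4) (frag_cmul 2 (frag_of D1))"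
      by (rule le_SigmaI[of _ _ 1 0 1]) (use sigma13 in \<open>simp add: r s\<close>)
    moreover have "le_Sigma p \<rho> X (frag_of D5) (frag_cmul 2 (frag_of D2))"
      by (rule le_SigmaI[of _ _ 1 1 0]) (use sigma12 in \<open>simp add: r s\<close>)
    ultimately show "?G \<subseteq> isotropy_semigroup p \<rho> X"
      using Dp1 Dp2 by (auto simp: isotropy_semigroup_def colors le_Sigma_refl)
  qed (auto intro: isotropy_semigroup_zero isotropy_semigroup_add)
  moreover have "(n1, n2, E) \<in> generated_monoid ?G"
    if mem: "(n1, n2, E) \<in> isotropy_semigroup p \<rho> X" for n1 n2 E
  proof -
    have nonneg: "0 \<le> Poly_Mapping.lookup E D" for D
      using mem by (simp add: isotropy_semigroup_def color_monoid_def)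
    from mem obtain c1 c2 c3 :: nat where
      "frag_cmul (int n1) (frag_of D1) + frag_cmul (int n2) (frag_of D2) - E
        = frag_cmul (int c1) s1 + frag_cmul (int c2) s2 + frag_cmul (int c3) s3"
      unfolding isotropy_semigroup_def le_Sigma_def sum_roots Dp1 Dp2 by blast
    then have E: "E = frag_cmul (int n1) (frag_of D1) + frag_cmul (int n2) (frag_of D2)
        - (frag_cmul (int c1) s1 + frag_cmul (int c2) s2 + frag_cmul (int c3) s3)"
      by (simp add: algebra_simps)
    have "Poly_Mapping.lookup E D1 = int n1 - int c1 + int c2 - int c3"
      "Poly_Mapping.lookup E D2 = int n2 - int c1 - int c2 + int c3"
      "Poly_Mapping.lookup E D3 = int c1 - int c2 - int c3"
      using distinct by (simp_all add: E s1 s2 s3 lookups)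
    then have c: "c1 + c3 \<le> n1 + c2" "c1 + c2 \<le> n2 + c3" "c2 + c3 \<le> c1"
      using nonneg[of D1] nonneg[of D2] nonneg[of D3] by linarith+
    \<comment> \<open>By \<open>c\<close> these subtractions of naturals do not truncate.\<close>
    define a1 a2 a3 where a: "a1 = n1 + c2 - (c1 + c3)" "a2 = n2 + c3 - (c1 + c2)"
      "a3 = c1 - (c2 + c3)"
    have c1: "c1 = a3 + c2 + c3" and n: "n1 = a1 + a3 + 2 * c3" "n2 = a2 + a3 + 2 * c2"
      using c unfolding a by linarith+
    have "E = frag_cmul (int a1) (frag_of D1) + frag_cmul (int a2) (frag_of D2)
        + frag_cmul (int a3) (frag_of D3) + frag_cmul (int c3) (frag_of D4)
        + frag_cmul (int c2) (frag_of D5)"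
      unfolding E s1 s2 s3 n c1
      \<comment> \<open>At each divisor this is a linear identity in the values of the
        \<open>frag_of\<close> terms, so it also covers \<open>D4 = D5\<close>.\<close>
      by (rule poly_mapping_eqI) (simp add: lookup_add lookup_minus algebra_simps)
    \<comment> \<open>Products such as \<open>a1 * 0\<close> are kept to match
      \<open>generated_monoid_cmul\<close>.\<close>
    then have "(n1, n2, E) = (a1 * 1, a1 * 0, frag_cmul (int a1) (frag_of D1))
        + (a2 * 0, a2 * 1, frag_cmul (int a2) (frag_of D2))
        + (a3 * 1, a3 * 1, frag_cmul (int a3) (frag_of D3))
        + (c3 * 2, c3 * 0, frag_cmul (int c3) (frag_of D4))
        + (c2 * 0, c2 * 2, frag_cmul (int c2) (frag_of D5))"
      by (simp add: n)
    also have "\<dots> \<in> generated_monoid ?G"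
      by (intro generated_monoid_add generated_monoid_cmul generated_monoid_incl) simp_all
    finally show ?thesis .
  qed
  ultimately show ?thesis
    by auto
qed

end
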